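(* Let $k=2$, $d=1$, and let $\mathcal X$ be the set of matrices $\mathbf X\in\mathbb{R}^{n\times k}$ whose rows are standard basis vectors. Any randomized algorithm which, given $\mathbf A\in\mathbb{R}^{n\times d}$ in a turnstile stream, outputs a number $c\ge0$ satisfying $$c\le\min_{\mathbf X\in\mathcal X,\ \mathbf D\in\mathbb{R}^{k\times d}}\|\mathbf X\mathbf D-\mathbf A\|_F^2\le 2c$$ in a constant number of passes requires $\Omega(n)$ bits of space.
   Context: In a turnstile stream, $\mathbf A$ is initialized to $0$ and receives arbitrary entrywise updates $\mathbf A_{i,j}\leftarrow\mathbf A_{i,j}+\Delta$ with $\Delta\in\mathbb{R}$. A randomized algorithm is required to succeed with constant probability (e.g. at least $2/3$). *)

theory Defs
  imports
    "HOL-Probability.Probability"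
    "HOL-Library.Landau_Symbols"
    "Jordan_Normal_Form.Matrix"
begin

section \<open>The clustering objective\<close>

definition assignment_mats :: "nat \<Rightarrow> nat \<Rightarrow> real mat set" where
  "assignment_mats n k =
     {X \<in> carrier_mat n k. \<forall>i<n. \<exists>j<k. Matrix.row X i = unit_vec k j}"

definition frob_sq :: "real mat \<Rightarrow> real" where
  "frob_sq B = (\<Sum>i<dim_row B. \<Sum>j<dim_col B. (B $$ (i, j))\<^sup>2)"

text \<open>For \<open>k \<ge> 1\<close> the infimum is a minimum: there are finitely many \<open>X\<close>, and for each of them
  the least-squares problem in \<open>D\<close> attains its optimum.\<close>

definition opt_cost :: "nat \<Rightarrow> nat \<Rightarrow> nat \<Rightarrow> real mat \<Rightarrow> real" where
  "opt_cost n k d A =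
     (INF (X, D) \<in> assignment_mats n k \<times> carrier_mat k d. frob_sq (X * D - A))"

section \<open>Turnstile streams\<close>

text \<open>The update \<open>(i, j, \<Delta>)\<close> adds \<open>\<Delta>\<close> to entry \<open>(i, j)\<close>; indices start at 0.\<close>

type_synonym update = "nat \<times> nat \<times> real"

fun apply_update :: "real mat \<Rightarrow> update \<Rightarrow> real mat" where
  "apply_update A (i, j, \<Delta>) =
     Matrix.mat (dim_row A) (dim_col A)
       (\<lambda>(r, c). if r = i \<and> c = j then A $$ (r, c) + \<Delta> else A $$ (r, c))"

definition stream_mat :: "nat \<Rightarrow> nat \<Rightarrow> update list \<Rightarrow> real mat" where
  "stream_mat n d \<sigma> = foldl apply_update (0\<^sub>m n d) \<sigma>"

definition turnstile_streams :: "nat \<Rightarrow> nat \<Rightarrow> update list set" where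
  "turnstile_streams n d = lists ({..<n} \<times> {..<d} \<times> (UNIV :: real set))"

text \<open>
  No fixed number of bits suffices to approximate the cost over all of \<open>turnstile_streams n 1\<close>
  when \<open>n \<ge> 3\<close>: rescaling the input gives infinitely many answers that are pairwise more than
  a factor 2 apart. A lower bound for algorithms that have to succeed on every real-valued stream
  is therefore true for a degenerate reason. The lower bound is stated for algorithms that have to
  succeed on any class of turnstile streams that contains the following finite one; the class of
  all turnstile streams is an instance. On the finite class, \<open>O(n log n)\<close> bits suffice.
\<close>

definition short_unit_streams :: "nat \<Rightarrow> nat \<Rightarrow> update list set" where
  "short_unit_streams n d =
     {\<sigma> \<in> lists ({..<n} \<times> {..<d} \<times> {- 1, 1}). length \<sigma> \<le> 2 * n * d}"

section \<open>Randomized multi-pass streaming algorithms\<close>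

text \<open>
  The algorithm draws an infinite random tape once, from a distribution of its own choice, and
  can consult it at any time at no cost in space. The transition function also sees the number of
  the current pass and the position in the stream for free. Hence the model contains the
  algorithms that toss fresh coins at every step (they read a new portion of the tape at each pair
  of pass and position) as well as those with a shared random string. Only the contents of the
  working memory, a string of bits, are charged. Transitions may be arbitrary functions; no
  computability is required.
\<close>

type_synonym tape = "nat \<Rightarrow> bool"

record stream_alg =
  tape_distr :: "tape measure"
  init_mem :: "tape \<Rightarrow> bool list"
  step_mem :: "tape \<Rightarrow> nat \<Rightarrow> nat \<Rightarrow> update \<Rightarrow> bool list \<Rightarrow> bool list"
    \<comment> \<open>tape, pass, position in the stream, update, old memory\<close>
  answer :: "tape \<Rightarrow> bool list \<Rightarrow> real"

definition uses_bits :: "stream_alg \<Rightarrow> nat \<Rightarrow> bool" where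
  "uses_bits alg s \<longleftrightarrow>
     (\<forall>\<rho> \<in> space (tape_distr alg).
        length (init_mem alg \<rho>) = s \<and>
        (\<forall>q t u m. length m = s \<longrightarrow> length (step_mem alg \<rho> q t u m) = s))"

fun run_pass :: "stream_alg \<Rightarrow> tape \<Rightarrow> nat \<Rightarrow> nat \<Rightarrow> update list \<Rightarrow> bool list \<Rightarrow> bool list" where
  "run_pass alg \<rho> q t [] m = m"
| "run_pass alg \<rho> q t (u # \<sigma>) m = run_pass alg \<rho> q (Suc t) \<sigma> (step_mem alg \<rho> q t u m)"

fun run_passes :: "stream_alg \<Rightarrow> tape \<Rightarrow> nat \<Rightarrow> update list \<Rightarrow> bool list" where
  "run_passes alg \<rho> 0 \<sigma> = init_mem alg \<rho>"
| "run_passes alg \<rho> (Suc q) \<sigma> = run_pass alg \<rho> q 0 \<sigma> (run_passes alg \<rho> q \<sigma>)"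

definition alg_output :: "stream_alg \<Rightarrow> nat \<Rightarrow> update list \<Rightarrow> tape \<Rightarrow> real" where
  "alg_output alg P \<sigma> \<rho> = answer alg \<rho> (run_passes alg \<rho> P \<sigma>)"

text \<open>A set that is not an event has \<open>measure\<close> 0, so for \<open>p > 0\<close> the bound below includes the
  measurability of the success event. The probability is over the tape only, for every fixed
  stream in \<open>S\<close>.\<close>

definition approximates_opt ::
  "stream_alg \<Rightarrow> nat \<Rightarrow> real \<Rightarrow> nat \<Rightarrow> nat \<Rightarrow> nat \<Rightarrow> update list set \<Rightarrow> bool" where
  "approximates_opt alg P p n k d S \<longleftrightarrow>
     prob_space (tape_distr alg) \<and>
     (\<forall>\<sigma> \<in> S.
        measure (tape_distr alg)
          {\<rho> \<in> space (tape_distr alg).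
             0 \<le> alg_output alg P \<sigma> \<rho> \<and>
             alg_output alg P \<sigma> \<rho> \<le> opt_cost n k d (stream_mat n d \<sigma>) \<and>
             opt_cost n k d (stream_mat n d \<sigma>) \<le> 2 * alg_output alg P \<sigma> \<rho>} \<ge> p)"

end

theory Submission
  imports Defs
begin

text \<open>
  The proof is a reduction from set disjointness. Alice and Bob each add \<open>\<plusminus>1\<close> to every coordinate
  according to their set, so the entries are \<open>-2\<close>, \<open>0\<close> and \<open>2\<close>; the value \<open>2\<close> marks a common element.
  Two clusters give cost 0 if and only if at most two values occur, so a factor 2 approximation decides
  whether the sets are disjoint. A \<open>P\<close>-pass algorithm with \<open>s\<close> bits is a protocol with at most
  \<open>2^(2Ps)\<close> transcripts, each of which corresponds to a combinatorial rectangle.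

  The bound for disjointness follows the information-cost argument with Hellinger distances. Let \<open>D\<close> be
  a random set of coordinates, \<open>z\<close> a random set, and give \<open>z \<inter> D\<close> to Alice and \<open>z - D\<close> to Bob. For
  each transcript the level-one inequality bounds how much it reveals about the single coordinates
  of \<open>z\<close>, and summed over the transcripts this is at most the logarithm of their number. On the other
  hand a correct protocol must distinguish \<open>(0,0)\<close> from \<open>(1,1)\<close> at a random coordinate. Rectangles make
  the distance between these two inputs equal to the one between \<open>(0,1)\<close> and \<open>(1,0)\<close>,
  and by the triangle inequality through \<open>(0,0)\<close> the transcript reveals a constant amount about
  each coordinate.
\<close>

section \<open>The level-one inequality and Hellinger distances\<close>

text \<open>With weight 1/2 and step \<open>2 * y\<close>, the logarithm in
  \<open>Hoeffdings_lemma_aux\<close> is that of \<open>exp y * cosh y\<close>, and the linear term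
  cancels \<open>exp y\<close>. Evenness of \<open>cosh\<close> covers negative arguments.\<close>

lemma cosh_le_exp_half_square:
  fixes x :: real
  shows "cosh x \<le> exp (x\<^sup>2 / 2)"
proof -
  have nonneg: "cosh y \<le> exp (y\<^sup>2 / 2)" if "y \<ge> 0" for y :: real
  proof -
    have "- (2 * y) * (1 / 2) + ln (1 + 1 / 2 * (exp (2 * y) - 1)) \<le> (2 * y)\<^sup>2 / 8"
      using that by (intro Hoeffdings_lemma_aux) auto
    hence "ln (1 + 1 / 2 * (exp (2 * y) - 1)) \<le> y + y\<^sup>2 / 2"
      by (simp add: power2_eq_square)
    moreover have "1 + 1 / 2 * (exp (2 * y) - 1) = exp y * cosh y"
      by (simp add: cosh_field_def field_simps flip: exp_add)
    ultimately have "ln (exp y * cosh y) \<le> y + y\<^sup>2 / 2"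
      by simp
    hence "exp y * cosh y \<le> exp (y + y\<^sup>2 / 2)"
      by (metis cosh_real_pos exp_gt_zero exp_le_cancel_iff exp_ln mult_pos_pos)
    thus ?thesis
      by (simp add: exp_add)
  qed
  show ?thesis
    using nonneg[of "\<bar>x\<bar>"] by (simp add: cosh_real_abs)
qed

text \<open>Subsets encode sign vectors, so this is the unnormalised moment generating function of a
  weighted sum of independent signs; it factorises by expanding the product of
  \<open>exp (v i) + exp (- v i)\<close>.\<close>

lemma sum_exp_signs_eq_prod_cosh:
  fixes v :: "'a \<Rightarrow> real"
  assumes "finite I"
  shows "(\<Sum>z\<in>Pow I. exp (\<Sum>i\<in>I. v i * (if i \<in> z then 1 else - 1))) = (\<Prod>i\<in>I. 2 * cosh (v i))"
proof -
  have "(\<Prod>i\<in>I. 2 * cosh (v i)) = (\<Prod>i\<in>I. exp (v i) + exp (- v i))"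
    by (intro prod.cong) (auto simp: cosh_field_def)
  also have "\<dots> = (\<Sum>z\<in>Pow I. (\<Prod>i\<in>z. exp (v i)) * (\<Prod>i\<in>I-z. exp (- v i)))"
    by (rule prod_add[OF assms])
  also have "\<dots> = (\<Sum>z\<in>Pow I. exp (\<Sum>i\<in>I. v i * (if i \<in> z then 1 else - 1)))"
  proof (rule sum.cong[OF refl])
    fix z assume "z \<in> Pow I"
    hence z: "z \<subseteq> I" "finite z" "finite (I - z)"
      using assms finite_subset by auto
    have "(\<Sum>i\<in>I. v i * (if i \<in> z then 1 else - 1)) = (\<Sum>i\<in>I-z. - v i) + (\<Sum>i\<in>z. v i)"
      by (subst sum.subset_diff[OF z(1) assms]) (auto intro!: arg_cong2[of _ _ _ _ "(+)"] sum.cong)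
    thus "(\<Prod>i\<in>z. exp (v i)) * (\<Prod>i\<in>I-z. exp (- v i)) =
        exp (\<Sum>i\<in>I. v i * (if i \<in> z then 1 else - 1))"
      using z by (simp add: exp_add exp_sum)
  qed
  finally show ?thesis by simp
qed

text \<open>Let \<open>v\<close> be the mean sign vector of \<open>Z\<close> and \<open>V\<close>
  its squared length. The mean of \<open>exp f\<close> on \<open>Z\<close> is at least
  \<open>exp V\<close>, while its sum over the whole cube is at most
  \<open>2 ^ card I * exp (V / 2)\<close>. Comparing the two bounds \<open>V\<close>.\<close>

lemma level_one_inequality:
  fixes Z :: "'a set set"
  assumes "finite I" "Z \<subseteq> Pow I"
  shows "(\<Sum>i\<in>I. (\<Sum>z\<in>Z. if i \<in> z then 1 else - 1)\<^sup>2)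
    \<le> 2 * (real (card Z))\<^sup>2 * ln (2 ^ card I / real (card Z))"
proof (cases "Z = {}")
  case False
  have finZ: "finite Z"
    using assms finite_subset by blast
  define c where "c = real (card Z)"
  have c: "c > 0"
    using False finZ by (simp add: c_def card_gt_0_iff)
  define s :: "'a set \<Rightarrow> 'a \<Rightarrow> real" where "s = (\<lambda>z i. if i \<in> z then 1 else - 1)"
  define v where "v i = (\<Sum>z\<in>Z. s z i) / c" for i
  define V where "V = (\<Sum>i\<in>I. (v i)\<^sup>2)"
  define f where "f z = (\<Sum>i\<in>I. v i * s z i)" for z
  have sum_f: "(\<Sum>z\<in>Z. f z) = c * V"
  proof -
    have "(\<Sum>z\<in>Z. f z) = (\<Sum>i\<in>I. v i * (\<Sum>z\<in>Z. s z i))"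
      unfolding f_def by (subst sum.swap) (simp add: sum_distrib_left)
    also have "\<dots> = (\<Sum>i\<in>I. v i * (c * v i))"
      using c by (simp add: v_def)
    finally show ?thesis
      by (simp add: V_def sum_distrib_left power2_eq_square mult_ac)
  qed
  \<comment> \<open>Jensen's inequality for \<open>exp\<close>, through the tangent line at \<open>V\<close>, the mean of \<open>f\<close> on \<open>Z\<close>.\<close>
  have "c * exp V = (\<Sum>z\<in>Z. exp V * (1 + (f z - V)))"
    using sum_f by (simp add: sum.distrib sum_subtractf algebra_simps c_def flip: sum_distrib_left)
  also have "\<dots> \<le> (\<Sum>z\<in>Z. exp (f z))"
  proof (rule sum_mono)
    fix z
    have "exp V * (1 + (f z - V)) \<le> exp V * exp (f z - V)"
      by (intro mult_left_mono exp_ge_add_one_self) auto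
    thus "exp V * (1 + (f z - V)) \<le> exp (f z)"
      by (simp flip: exp_add)
  qed
  also have "\<dots> \<le> (\<Sum>z\<in>Pow I. exp (f z))"
    using assms by (intro sum_mono2) auto
  also have "\<dots> = (\<Prod>i\<in>I. 2 * cosh (v i))"
    unfolding f_def s_def by (rule sum_exp_signs_eq_prod_cosh[OF assms(1)])
  also have "\<dots> \<le> (\<Prod>i\<in>I. 2 * exp ((v i)\<^sup>2 / 2))"
    by (intro prod_mono) (auto simp: cosh_le_exp_half_square)
  also have "\<dots> = 2 ^ card I * exp (V / 2)"
    using assms by (simp add: prod.distrib V_def exp_sum sum_divide_distrib)
  finally have "c * (exp (V / 2) * exp (V / 2)) \<le> 2 ^ card I * exp (V / 2)"
    by (simp flip: exp_add)
  hence "exp (V / 2) \<le> 2 ^ card I / c"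
    using c by (simp add: field_simps)
  hence "V / 2 \<le> ln (2 ^ card I / c)"
    using c by (subst ln_ge_iff) auto
  hence "c\<^sup>2 * V \<le> c\<^sup>2 * (2 * ln (2 ^ card I / c))"
    by (intro mult_left_mono) auto
  moreover have "(\<Sum>i\<in>I. (\<Sum>z\<in>Z. s z i)\<^sup>2) = c\<^sup>2 * V"
    using c by (simp add: V_def v_def sum_distrib_left power_divide)
  ultimately show ?thesis
    by (simp add: s_def c_def mult_ac)
qed simp

text \<open>The uniform distribution maximises entropy. Termwise this is
  \<open>ln x \<le> x - 1\<close>, whose error terms \<open>W / M - w t\<close> sum to zero.\<close>

lemma entropy_le_ln_card:
  fixes w :: "'t \<Rightarrow> real"
  assumes "finite T" and nonneg: "\<And>t. t \<in> T \<Longrightarrow> w t \<ge> 0" and "W = sum w T" "W > 0"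
  shows "(\<Sum>t\<in>T. w t * ln (W / w t)) \<le> W * ln (card T)"
proof -
  have "T \<noteq> {}"
    using assms by auto
  define M where "M = real (card T)"
  have M: "M > 0"
    using assms \<open>T \<noteq> {}\<close> by (simp add: M_def card_gt_0_iff)
  have "(\<Sum>t\<in>T. w t * ln (W / w t)) \<le> (\<Sum>t\<in>T. w t * ln M + (W / M - w t))"
  proof (rule sum_mono)
    fix t assume t: "t \<in> T"
    show "w t * ln (W / w t) \<le> w t * ln M + (W / M - w t)"
    proof (cases "w t = 0")
      case False
      hence w: "w t > 0"
        using nonneg[OF t] by simp
      have "ln (W / w t) = ln M + ln (W / (M * w t))"
        using w M assms(4) by (simp add: ln_div ln_mult)
      also have "ln (W / (M * w t)) \<le> W / (M * w t) - 1"
        using w M assms(4) by (intro ln_le_minus_one) auto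
      finally have "w t * ln (W / w t) \<le> w t * (ln M + (W / (M * w t) - 1))"
        using w by (intro mult_left_mono) auto
      also have "w t * (ln M + (W / (M * w t) - 1)) = w t * ln M + (W / M - w t)"
        using w M by (simp add: field_simps)
      finally show ?thesis .
    qed (use M assms(4) in auto)
  qed
  also have "\<dots> = W * ln M"
    using M assms(3) by (simp add: sum.distrib sum_subtractf M_def flip: sum_distrib_right)
  finally show ?thesis
    by (simp add: M_def)
qed

text \<open>Multiply by \<open>(sqrt a + sqrt b)\<^sup>2\<close>, which is at least
  \<open>a + b\<close>. For \<open>a = b = 0\<close> both sides are 0.\<close>

lemma square_diff_sqrt_le:
  fixes a b :: real
  assumes "a \<ge> 0" "b \<ge> 0"
  shows "(sqrt a - sqrt b)\<^sup>2 \<le> (a - b)\<^sup>2 / (a + b)"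
proof (cases "a + b = 0")
  case True
  hence "a = 0" "b = 0"
    using assms by auto
  thus ?thesis by simp
next
  case False
  have "a + b \<le> (sqrt a + sqrt b)\<^sup>2"
    using assms by (simp add: power2_sum)
  hence "(sqrt a - sqrt b)\<^sup>2 * (a + b) \<le> (sqrt a - sqrt b)\<^sup>2 * (sqrt a + sqrt b)\<^sup>2"
    by (intro mult_left_mono) auto
  also have "\<dots> = (a - b)\<^sup>2"
    using assms by (simp add: square_diff_square_factored[symmetric] flip: power_mult_distrib)
      (simp add: algebra_simps)
  finally show ?thesis
    using False assms by (simp add: pos_le_divide_eq)
qed

text \<open>On a fibre \<open>Z t\<close> the two counts add up to its size and differ by the sum of
  signs at \<open>i\<close>. So the level-one inequality bounds each fibre by an entropy term, and
  the fibre sizes sum to \<open>2 ^ card I\<close>.\<close>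

lemma sum_hellinger_le:
  fixes \<pi> :: "'a set \<Rightarrow> 't"
  assumes "finite I" "finite T" and \<pi>: "\<And>z. z \<subseteq> I \<Longrightarrow> \<pi> z \<in> T"
  shows "(\<Sum>i\<in>I. \<Sum>t\<in>T. (sqrt (card {z\<in>Pow I. i \<notin> z \<and> \<pi> z = t})
             - sqrt (card {z\<in>Pow I. i \<in> z \<and> \<pi> z = t}))\<^sup>2)
         \<le> 2 * 2 ^ card I * ln (card T)"
proof -
  define Z where "Z t = {z\<in>Pow I. \<pi> z = t}" for t
  have fin: "finite (Z t)" for t
    using assms by (simp add: Z_def)
  define w0 w1 where "w0 i t = real (card {z\<in>Pow I. i \<notin> z \<and> \<pi> z = t})"
    and "w1 i t = real (card {z\<in>Pow I. i \<in> z \<and> \<pi> z = t})" for i t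
  have Zsplit: "Z t \<inter> {z. i \<in> z} = {z\<in>Pow I. i \<in> z \<and> \<pi> z = t}"
    "Z t \<inter> - {z. i \<in> z} = {z\<in>Pow I. i \<notin> z \<and> \<pi> z = t}" for i t
    by (auto simp: Z_def)
  have w_add: "w0 i t + w1 i t = real (card (Z t))" for i t
    using card_Int_Diff[OF fin, of t "{z. i \<in> z}"] by (simp add: w0_def w1_def Diff_eq Zsplit)
  have w_diff: "w1 i t - w0 i t = (\<Sum>z\<in>Z t. if i \<in> z then 1 else - 1)" for i t
    using sum.If_cases[OF fin, of "\<lambda>z. i \<in> z" "\<lambda>_. 1::real" "\<lambda>_. - 1" t]
    by (simp add: w0_def w1_def Zsplit)
  have "(\<Sum>i\<in>I. \<Sum>t\<in>T. (sqrt (w0 i t) - sqrt (w1 i t))\<^sup>2)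
      \<le> (\<Sum>i\<in>I. \<Sum>t\<in>T. (w1 i t - w0 i t)\<^sup>2 / real (card (Z t)))"
  proof (intro sum_mono)
    fix i t
    show "(sqrt (w0 i t) - sqrt (w1 i t))\<^sup>2 \<le> (w1 i t - w0 i t)\<^sup>2 / real (card (Z t))"
      using square_diff_sqrt_le[of "w0 i t" "w1 i t"]
      by (simp add: w_add power2_commute) (simp add: w0_def w1_def)
  qed
  also have "\<dots> = (\<Sum>t\<in>T. (\<Sum>i\<in>I. (\<Sum>z\<in>Z t. if i \<in> z then 1 else - 1)\<^sup>2) / real (card (Z t)))"
    by (subst sum.swap) (simp add: w_diff sum_divide_distrib)
  also have "\<dots> \<le> (\<Sum>t\<in>T. 2 * (real (card (Z t)) * ln (2 ^ card I / real (card (Z t)))))"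
  proof (rule sum_mono)
    fix t
    have "(\<Sum>i\<in>I. (\<Sum>z\<in>Z t. if i \<in> z then 1 else - 1)\<^sup>2) / real (card (Z t))
        \<le> 2 * (real (card (Z t)))\<^sup>2 * ln (2 ^ card I / real (card (Z t))) / real (card (Z t))"
      using assms by (intro divide_right_mono level_one_inequality) (auto simp: Z_def)
    thus "(\<Sum>i\<in>I. (\<Sum>z\<in>Z t. if i \<in> z then 1 else - 1)\<^sup>2) / real (card (Z t))
        \<le> 2 * (real (card (Z t)) * ln (2 ^ card I / real (card (Z t))))"
      by (cases "card (Z t) = 0") (simp_all add: power2_eq_square)
  qed
  also have "\<dots> \<le> 2 * (2 ^ card I * ln (card T))"
  proof -
    have "(\<Sum>t\<in>T. card (Z t)) = card (\<Union>t\<in>T. Z t)"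
      using assms fin by (subst card_UN_disjoint) (auto simp: Z_def)
    also have "(\<Union>t\<in>T. Z t) = Pow I"
      using \<pi> by (auto simp: Z_def)
    finally have "(\<Sum>t\<in>T. real (card (Z t))) = 2 ^ card I"
      using assms by (simp add: card_Pow flip: of_nat_sum)
    thus ?thesis
      using entropy_le_ln_card[OF assms(2), of "\<lambda>t. real (card (Z t))" "2 ^ card I"]
      by (simp flip: sum_distrib_left)
  qed
  finally show ?thesis
    by (simp add: w0_def w1_def mult_ac)
qed

section \<open>Disjointness\<close>

text \<open>Independence of the two players' inputs once \<open>D\<close> is fixed: a set
  \<open>z\<close> is the same as the pair of its parts inside and outside \<open>D\<close>.\<close>

lemma card_Pow_product:
  assumes "finite S" "D \<subseteq> S"
  shows "card {z\<in>Pow S. P (z \<inter> D) \<and> Q (z - D)} = card {x\<in>Pow D. P x} * card {y\<in>Pow (S - D). Q y}"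
proof -
  have "bij_betw (\<lambda>(x, y). x \<union> y) ({x\<in>Pow D. P x} \<times> {y\<in>Pow (S - D). Q y})
      {z\<in>Pow S. P (z \<inter> D) \<and> Q (z - D)}"
  proof (rule bij_betwI[where g = "\<lambda>z. (z \<inter> D, z - D)"])
    have split: "(x \<union> y) \<inter> D = x" "(x \<union> y) - D = y" if "x \<subseteq> D" "y \<subseteq> S - D" for x y
      using that by blast+
    show "(\<lambda>(x, y). x \<union> y) \<in> {x\<in>Pow D. P x} \<times> {y\<in>Pow (S - D). Q y}
        \<rightarrow> {z\<in>Pow S. P (z \<inter> D) \<and> Q (z - D)}"
    proof
      fix w assume w: "w \<in> {x\<in>Pow D. P x} \<times> {y\<in>Pow (S - D). Q y}"
      obtain x y where xy: "w = (x, y)" "x \<subseteq> D" "y \<subseteq> S - D" "P x" "Q y"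
        using w by blast
      moreover have "x \<union> y \<subseteq> S"
        using xy assms(2) by blast
      ultimately show "(\<lambda>(x, y). x \<union> y) w \<in> {z\<in>Pow S. P (z \<inter> D) \<and> Q (z - D)}"
        using split[of x y] by simp
    qed
    show "(\<lambda>z. (z \<inter> D, z - D)) \<in> {z\<in>Pow S. P (z \<inter> D) \<and> Q (z - D)}
        \<rightarrow> {x\<in>Pow D. P x} \<times> {y\<in>Pow (S - D). Q y}"
      by auto
    show "(\<lambda>z. (z \<inter> D, z - D)) ((\<lambda>(x, y). x \<union> y) w) = w"
      if "w \<in> {x\<in>Pow D. P x} \<times> {y\<in>Pow (S - D). Q y}" for w
      using that split by (cases w) simp
    show "(\<lambda>(x, y). x \<union> y) (z \<inter> D, z - D) = z" for z
      by auto
  qed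
  from bij_betw_same_card[OF this] show ?thesis
    by (simp only: card_cartesian_product)
qed

lemma sum_Pow_remove:
  fixes f :: "'a set \<Rightarrow> real"
  assumes "finite I" "i \<in> I"
  shows "(\<Sum>D\<in>Pow I. f D) = (\<Sum>D\<in>Pow (I - {i}). f D + f (insert i D))"
proof -
  have "Pow I = Pow (I - {i}) \<union> insert i ` Pow (I - {i})"
    using assms(2) Pow_insert[of i "I - {i}"] by (simp add: insert_absorb)
  hence "(\<Sum>D\<in>Pow I. f D) = (\<Sum>D\<in>Pow (I - {i}). f D) + (\<Sum>D\<in>insert i ` Pow (I - {i}). f D)"
    using assms(1) by (simp only:) (subst sum.union_disjoint; auto)
  also have "(\<Sum>D\<in>insert i ` Pow (I - {i}). f D) = (\<Sum>D\<in>Pow (I - {i}). f (insert i D))"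
    by (subst sum.reindex) (auto simp: inj_on_def)
  finally show ?thesis
    by (simp add: sum.distrib)
qed

text \<open>Factor \<open>a t - b t\<close> through square roots and apply the weighted AM-GM
  inequality. In the application \<epsilon> is the advantage over guessing, and the loss
  \<open>\<epsilon> * N / 2\<close> uses up half of it.\<close>

lemma sum_diff_le_hellinger:
  fixes a b :: "'t \<Rightarrow> real"
  assumes "finite T" "\<And>t. a t \<ge> 0" "\<And>t. b t \<ge> 0" "sum a T = N" "sum b T = N" "\<epsilon> > 0"
  shows "(\<Sum>t\<in>T. of_bool (out t) * (a t - b t))
    \<le> 2 / \<epsilon> * (\<Sum>t\<in>T. (sqrt (a t) - sqrt (b t))\<^sup>2) + \<epsilon> * N / 2"
proof -
  have "of_bool (out t) * (a t - b t) \<le> 2 / \<epsilon> * (sqrt (a t) - sqrt (b t))\<^sup>2 + \<epsilon> / 4 * (a t + b t)" for t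
  proof -
    define u v where "u = \<bar>sqrt (a t) - sqrt (b t)\<bar>" and "v = sqrt (a t) + sqrt (b t)"
    have "of_bool (out t) * (a t - b t) \<le> \<bar>a t - b t\<bar>"
      by (cases "out t") auto
    also have "\<dots> = \<bar>(sqrt (a t) - sqrt (b t)) * v\<bar>"
      using assms(2,3)[of t] by (simp add: v_def algebra_simps)
    also have "\<dots> = u * v"
      using assms(2,3)[of t] by (simp add: u_def v_def abs_mult)
    also have "u * v \<le> 2 / \<epsilon> * u\<^sup>2 + \<epsilon> / 8 * v\<^sup>2"
    proof -
      have "0 \<le> (4 * u - \<epsilon> * v)\<^sup>2 / (8 * \<epsilon>)"
        using assms(6) by simp
      also have "\<dots> = 2 / \<epsilon> * u\<^sup>2 + \<epsilon> / 8 * v\<^sup>2 - u * v"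
        using assms(6) by (simp add: power2_eq_square field_simps)
      finally show ?thesis by simp
    qed
    also have "\<dots> \<le> 2 / \<epsilon> * u\<^sup>2 + \<epsilon> / 8 * (2 * (a t + b t))"
    proof -
      have "v\<^sup>2 + (sqrt (a t) - sqrt (b t))\<^sup>2 = 2 * (a t + b t)"
        using assms(2,3)[of t] by (simp add: v_def power2_sum power2_diff)
      hence "v\<^sup>2 \<le> 2 * (a t + b t)"
        using zero_le_power2[of "sqrt (a t) - sqrt (b t)"] by linarith
      thus ?thesis
        using assms(6) by (intro add_left_mono mult_left_mono) auto
    qed
    also have "\<dots> = 2 / \<epsilon> * (sqrt (a t) - sqrt (b t))\<^sup>2 + \<epsilon> / 4 * (a t + b t)"
      by (simp add: u_def field_simps)
    finally show ?thesis .
  qed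
  hence "(\<Sum>t\<in>T. of_bool (out t) * (a t - b t))
      \<le> (\<Sum>t\<in>T. 2 / \<epsilon> * (sqrt (a t) - sqrt (b t))\<^sup>2 + \<epsilon> / 4 * (a t + b t))"
    by (intro sum_mono)
  also have "\<dots> = 2 / \<epsilon> * (\<Sum>t\<in>T. (sqrt (a t) - sqrt (b t))\<^sup>2) + \<epsilon> / 4 * (N + N)"
    by (simp only: sum.distrib assms(4,5) flip: sum_distrib_left)
  finally show ?thesis
    by (simp add: mult.commute)
qed

text \<open>The pairs (0,0), (1,1) and (1,0), (0,1) have the same cross term \<open>c t\<close>, and
  all totals equal \<open>N\<close>, so their Hellinger distances agree. The triangle inequality
  through (0,0) then costs a factor 2 on squares.\<close>

lemma cut_and_paste:
  fixes a0 a1 b0 b1 :: "'t \<Rightarrow> real"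
  assumes "\<And>t. a0 t \<ge> 0" "\<And>t. a1 t \<ge> 0" "\<And>t. b0 t \<ge> 0" "\<And>t. b1 t \<ge> 0"
    and sums: "(\<Sum>t\<in>T. a0 t * b0 t) = N" "(\<Sum>t\<in>T. a0 t * b1 t) = N"
      "(\<Sum>t\<in>T. a1 t * b0 t) = N" "(\<Sum>t\<in>T. a1 t * b1 t) = N"
  shows "(\<Sum>t\<in>T. (sqrt (a0 t * b0 t) - sqrt (a1 t * b1 t))\<^sup>2)
    \<le> 2 * (\<Sum>t\<in>T. (sqrt (a0 t * b0 t) - sqrt (a1 t * b0 t))\<^sup>2)
      + 2 * (\<Sum>t\<in>T. (sqrt (a0 t * b0 t) - sqrt (a0 t * b1 t))\<^sup>2)"
proof -
  define c where "c t = sqrt (a0 t) * sqrt (b0 t) * sqrt (a1 t) * sqrt (b1 t)" for t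
  have "(\<Sum>t\<in>T. (sqrt (a0 t * b0 t) - sqrt (a1 t * b1 t))\<^sup>2)
      = (\<Sum>t\<in>T. a0 t * b0 t + a1 t * b1 t - 2 * c t)"
    using assms by (intro sum.cong) (auto simp: c_def real_sqrt_mult power2_diff power_mult_distrib)
  also have "\<dots> = (\<Sum>t\<in>T. a1 t * b0 t + a0 t * b1 t - 2 * c t)"
    by (simp add: sum.distrib sum_subtractf sums)
  also have "\<dots> = (\<Sum>t\<in>T. (sqrt (a1 t * b0 t) - sqrt (a0 t * b1 t))\<^sup>2)"
    using assms by (intro sum.cong) (auto simp: c_def real_sqrt_mult power2_diff power_mult_distrib)
  also have "\<dots> \<le> (\<Sum>t\<in>T. 2 * (sqrt (a0 t * b0 t) - sqrt (a1 t * b0 t))\<^sup>2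
      + 2 * (sqrt (a0 t * b0 t) - sqrt (a0 t * b1 t))\<^sup>2)"
  proof (rule sum_mono)
    fix t
    have "(x - y)\<^sup>2 \<le> 2 * (z - x)\<^sup>2 + 2 * (z - y)\<^sup>2" for x y z :: real
    proof -
      have "2 * (z - x)\<^sup>2 + 2 * (z - y)\<^sup>2 - (x - y)\<^sup>2 = (2 * z - x - y)\<^sup>2"
        by (simp add: power2_eq_square algebra_simps)
      thus ?thesis
        using zero_le_power2[of "2 * z - x - y"] by linarith
    qed
    thus "(sqrt (a1 t * b0 t) - sqrt (a0 t * b1 t))\<^sup>2 \<le> 2 * (sqrt (a0 t * b0 t) - sqrt (a1 t * b0 t))\<^sup>2
      + 2 * (sqrt (a0 t * b0 t) - sqrt (a0 t * b1 t))\<^sup>2" .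
  qed
  finally show ?thesis
    by (simp add: sum.distrib sum_distrib_left)
qed

lemma sum_card_fibres:
  assumes "finite S" "finite T" "\<And>z. z \<in> S \<Longrightarrow> f z \<in> T"
  shows "(\<Sum>t\<in>T. g t * real (card {z\<in>S. f z = t})) = (\<Sum>z\<in>S. g (f z))"
proof -
  have "(\<Sum>z\<in>S. g (f z)) = (\<Sum>t\<in>T. \<Sum>z\<in>{z\<in>S. f z = t}. g (f z))"
    using assms by (intro sum.group[symmetric]) auto
  also have "\<dots> = (\<Sum>t\<in>T. g t * real (card {z\<in>S. f z = t}))"
    by (intro sum.cong) (auto simp: mult.commute)
  finally show ?thesis by simp
qed

text \<open>\<open>\<tau> x y\<close> is the transcript, and \<open>out t\<close> says that a transcript \<open>t\<close> declares the sets disjoint.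
  The hypothesis on success averages over the disjoint inputs \<open>(z \<inter> D, z - D)\<close> with coordinate \<open>i\<close>
  in neither set and the inputs obtained from them by putting \<open>i\<close> into both.\<close>
lemma disjointness_transcript_bound:
  fixes I :: "'a set" and \<tau> :: "'a set \<Rightarrow> 'a set \<Rightarrow> 't" and p :: real
  assumes "finite I" "finite T"
    and \<tau>: "\<And>x y. x \<subseteq> I \<Longrightarrow> y \<subseteq> I \<Longrightarrow> \<tau> x y \<in> T"
    and rectangle: "\<And>x y t. x \<subseteq> I \<Longrightarrow> y \<subseteq> I \<Longrightarrow> t \<in> T \<Longrightarrow> \<tau> x y = t \<longleftrightarrow> A t x \<and> B t y"
    and "p > 1 / 2"
    and success: "p * (\<Sum>i\<in>I. \<Sum>D\<in>Pow (I - {i}). \<Sum>z\<in>Pow (I - {i}). 2)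
      \<le> (\<Sum>i\<in>I. \<Sum>D\<in>Pow (I - {i}). \<Sum>z\<in>Pow (I - {i}).
           of_bool (out (\<tau> (z \<inter> D) (z - D)))
           + of_bool (\<not> out (\<tau> (insert i (z \<inter> D)) (insert i (z - D)))))"
  shows "(2 * p - 1)\<^sup>2 * card I \<le> 64 * ln (card T)"
proof (cases "I = {}")
  case True
  have "T \<noteq> {}"
    using \<tau>[of "{}" "{}"] by auto
  with True \<open>finite T\<close> show ?thesis
    by (simp add: Suc_le_eq card_gt_0_iff)
next
  case False
  define m where "m = card I"
  have m: "m > 0"
    using False assms(1) by (simp add: m_def card_gt_0_iff)
  define \<epsilon> where "\<epsilon> = 2 * p - 1"
  have \<epsilon>: "\<epsilon> > 0"
    using \<open>p > 1 / 2\<close> by (simp add: \<epsilon>_def)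
  define N :: real where "N = 2 ^ (m - 1)"
  have N: "N > 0" "2 * N = 2 ^ m"
    using m by (simp_all add: N_def flip: power_Suc)
  have card_Pow_remove: "real (card (Pow (I - {i}))) = N" if "i \<in> I" for i
    using that assms(1) by (simp add: card_Pow N_def m_def)
  \<comment> \<open>Up to the factor \<open>N\<close>, \<open>K i D u v\<close> is the distribution of the transcript when coordinate \<open>i\<close> is
    set to \<open>u\<close> for Alice and to \<open>v\<close> for Bob.\<close>
  define K where "K i D u v t = real (card {z\<in>Pow (I - {i}). \<tau> (z \<inter> D \<union> u) (z - D \<union> v) = t})"
    for i D u v t
  define H where "H i D u v u' v' = (\<Sum>t\<in>T. (sqrt (K i D u v t) - sqrt (K i D u' v' t))\<^sup>2)"
    for i D u v u' v'

  have K_sum: "(\<Sum>t\<in>T. g t * K i D u v t) = (\<Sum>z\<in>Pow (I - {i}). g (\<tau> (z \<inter> D \<union> u) (z - D \<union> v)))"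
    if "i \<in> I" "u \<subseteq> {i}" "v \<subseteq> {i}" for g i D u v
    unfolding K_def using that assms(1,2) by (intro sum_card_fibres \<tau>) auto
  have K_total: "(\<Sum>t\<in>T. K i D u v t) = N" if "i \<in> I" "u \<subseteq> {i}" "v \<subseteq> {i}" for i D u v
    using K_sum[OF that, of "\<lambda>_. 1"] card_Pow_remove[OF that(1)] by simp
  define a where "a D u t = real (card {x\<in>Pow D. A t (x \<union> u)})" for D u t
  define b where "b i D v t = real (card {y\<in>Pow (I - {i} - D). B t (y \<union> v)})" for i D v t
  \<comment> \<open>Rectangles meet independence here: Alice's factor does not depend on
    \<open>v\<close>, nor Bob's on \<open>u\<close>, as \<open>cut_and_paste\<close>
    requires.\<close>
  have K_prod: "K i D u v t = a D u t * b i D v t"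
    if "i \<in> I" "D \<subseteq> I - {i}" "u \<subseteq> {i}" "v \<subseteq> {i}" "t \<in> T" for i D u v t
  proof -
    have "{z\<in>Pow (I - {i}). \<tau> (z \<inter> D \<union> u) (z - D \<union> v) = t}
        = {z\<in>Pow (I - {i}). A t (z \<inter> D \<union> u) \<and> B t (z - D \<union> v)}"
      using that by (intro Collect_cong conj_cong refl rectangle) auto
    thus ?thesis
      unfolding K_def a_def b_def
      using card_Pow_product[of "I - {i}" D "\<lambda>x. A t (x \<union> u)" "\<lambda>y. B t (y \<union> v)"] that assms(1)
      by simp
  qed

  have H_cut: "H i D {} {} {i} {i} \<le> 2 * H i D {} {} {i} {} + 2 * H i D {} {} {} {i}"
    if "i \<in> I" "D \<subseteq> I - {i}" for i D
  proof -
    have sums: "(\<Sum>t\<in>T. a D u t * b i D v t) = N" if "u \<subseteq> {i}" "v \<subseteq> {i}" for u v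
      using K_total[of i u v D] K_prod[of i D u v] that \<open>i \<in> I\<close> \<open>D \<subseteq> I - {i}\<close> by simp
    have "(\<Sum>t\<in>T. (sqrt (a D {} t * b i D {} t) - sqrt (a D {i} t * b i D {i} t))\<^sup>2)
        \<le> 2 * (\<Sum>t\<in>T. (sqrt (a D {} t * b i D {} t) - sqrt (a D {i} t * b i D {} t))\<^sup>2)
          + 2 * (\<Sum>t\<in>T. (sqrt (a D {} t * b i D {} t) - sqrt (a D {} t * b i D {i} t))\<^sup>2)"
      by (rule cut_and_paste[OF _ _ _ _ sums sums sums sums]) (simp_all add: a_def b_def)
    thus ?thesis
      unfolding H_def using that by (simp add: K_prod cong: sum.cong)
  qed

  define h where "h i D = (\<Sum>t\<in>T. (sqrt (card {z\<in>Pow I. i \<notin> z \<and> \<tau> (z \<inter> D) (z - D) = t})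
      - sqrt (card {z\<in>Pow I. i \<in> z \<and> \<tau> (z \<inter> D) (z - D) = t}))\<^sup>2)" for i D
  have Pow_remove: "{z\<in>Pow I. i \<notin> z \<and> Q z} = {z\<in>Pow (I - {i}). Q z}" for i Q
    by auto
  have card_Pow_insert: "card {z\<in>Pow I. i \<in> z \<and> Q z} = card {z\<in>Pow (I - {i}). Q (insert i z)}"
    if "i \<in> I" for i Q
  proof (rule bij_betw_same_card[symmetric])
    show "bij_betw (insert i) {z\<in>Pow (I - {i}). Q (insert i z)} {z\<in>Pow I. i \<in> z \<and> Q z}"
      using that by (intro bij_betwI[where g = "\<lambda>z. z - {i}"]) (auto simp: insert_absorb)
  qed
  \<comment> \<open>If \<open>i\<close> is outside \<open>D\<close>, then flipping it in
    \<open>z\<close> changes only Bob's input; after adding \<open>i\<close> to \<open>D\<close> it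
    changes only Alice's. Both short distances are thus values of \<open>h\<close>, and together
    they run over all of \<open>Pow I\<close>.\<close>
  have H_eq: "H i D {} {} {} {i} = h i D" "H i D {} {} {i} {} = h i (insert i D)"
    if i: "i \<in> I" and D: "D \<subseteq> I - {i}" for i D
  proof -
    have ins: "insert i z \<inter> D = z \<inter> D" "insert i z - D = insert i (z - D)"
      "insert i z \<inter> insert i D = insert i (z \<inter> D)" for z
      using D by auto
    have del: "z \<inter> insert i D = z \<inter> D" "z - insert i D = z - D" "insert i z - insert i D = z - D"
      if "z \<in> Pow (I - {i})" for z
      using that by auto
    have K00: "K i D {} {} t = card {z\<in>Pow I. i \<notin> z \<and> \<tau> (z \<inter> D) (z - D) = t}" for t
      unfolding Pow_remove by (simp only: K_def Un_empty_right)
    have K00': "K i D {} {} t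
        = card {z\<in>Pow I. i \<notin> z \<and> \<tau> (z \<inter> insert i D) (z - insert i D) = t}" for t
      unfolding Pow_remove by (simp only: K_def Un_empty_right del cong: conj_cong)
    have K01: "K i D {} {i} t = card {z\<in>Pow I. i \<in> z \<and> \<tau> (z \<inter> D) (z - D) = t}" for t
      unfolding card_Pow_insert[OF i] by (simp only: K_def Un_empty_right ins Un_insert_right)
    have K10: "K i D {i} {} t
        = card {z\<in>Pow I. i \<in> z \<and> \<tau> (z \<inter> insert i D) (z - insert i D) = t}" for t
      unfolding card_Pow_insert[OF i]
      by (simp only: K_def Un_empty_right Un_insert_right ins del cong: conj_cong)
    show "H i D {} {} {} {i} = h i D"
      by (simp only: H_def h_def K00 K01)
    show "H i D {} {} {i} {} = h i (insert i D)"
      by (simp only: H_def h_def K00' K10)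
  qed
  have "(\<Sum>i\<in>I. \<Sum>D\<in>Pow (I - {i}). H i D {} {} {i} {i})
      \<le> (\<Sum>i\<in>I. \<Sum>D\<in>Pow (I - {i}). 2 * (h i D + h i (insert i D)))"
  proof (intro sum_mono)
    fix i D assume "i \<in> I" "D \<in> Pow (I - {i})"
    thus "H i D {} {} {i} {i} \<le> 2 * (h i D + h i (insert i D))"
      using H_cut[of i D] H_eq[of i D] by simp
  qed
  also have "\<dots> = 2 * (\<Sum>D\<in>Pow I. \<Sum>i\<in>I. h i D)"
  proof -
    have "(\<Sum>D\<in>Pow I. \<Sum>i\<in>I. h i D) = (\<Sum>i\<in>I. \<Sum>D\<in>Pow (I - {i}). h i D + h i (insert i D))"
      using assms(1) by (subst sum.swap) (intro sum.cong refl sum_Pow_remove)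
    thus ?thesis
      by (simp only: sum_distrib_left)
  qed
  also have "\<dots> \<le> 2 * (\<Sum>D\<in>Pow I. 2 * 2 ^ card I * ln (card T))"
    unfolding h_def using assms(1,2) by (intro mult_left_mono sum_mono sum_hellinger_le \<tau>) auto
  \<comment> \<open>There are \<open>2 ^ m = 2 * N\<close> choices of \<open>D\<close>.\<close>
  also have "\<dots> = 16 * N\<^sup>2 * ln (card T)"
    using assms(1) by (simp add: card_Pow power2_eq_square flip: m_def N(2))
  finally have upper: "(\<Sum>i\<in>I. \<Sum>D\<in>Pow (I - {i}). H i D {} {} {i} {i}) \<le> 16 * N\<^sup>2 * ln (card T)" .

  have "p * (2 * (m * N\<^sup>2)) = p * (\<Sum>i\<in>I. \<Sum>D\<in>Pow (I - {i}). \<Sum>z\<in>Pow (I - {i}). 2)"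
    by (simp add: card_Pow_remove m_def power2_eq_square)
  also note success
  also have "(\<Sum>i\<in>I. \<Sum>D\<in>Pow (I - {i}). \<Sum>z\<in>Pow (I - {i}).
           of_bool (out (\<tau> (z \<inter> D) (z - D)))
           + of_bool (\<not> out (\<tau> (insert i (z \<inter> D)) (insert i (z - D)))))
      \<le> (\<Sum>i\<in>I. \<Sum>D\<in>Pow (I - {i}). N + \<epsilon> * N / 2 + 2 / \<epsilon> * H i D {} {} {i} {i})"
  proof (intro sum_mono)
    fix i D assume i: "i \<in> I" and D: "D \<in> Pow (I - {i})"
    have "(\<Sum>z\<in>Pow (I - {i}). of_bool (out (\<tau> (z \<inter> D) (z - D)))
           + of_bool (\<not> out (\<tau> (insert i (z \<inter> D)) (insert i (z - D)))) :: real)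
        = (\<Sum>t\<in>T. of_bool (out t) * K i D {} {} t) + (\<Sum>t\<in>T. of_bool (\<not> out t) * K i D {i} {i} t)"
      using i by (simp add: K_sum sum.distrib)
    \<comment> \<open>Rejections are the total \<open>N\<close> minus acceptances, so success beyond
      \<open>N\<close> measures how far the two transcript distributions differ.\<close>
    also have "(\<Sum>t\<in>T. of_bool (\<not> out t) * K i D {i} {i} t) = (\<Sum>t\<in>T. K i D {i} {i} t - of_bool (out t) * K i D {i} {i} t)"
      by (intro sum.cong) auto
    also have "(\<Sum>t\<in>T. of_bool (out t) * K i D {} {} t) + \<dots>
        = N + (\<Sum>t\<in>T. of_bool (out t) * (K i D {} {} t - K i D {i} {i} t))"
      using i K_total[of i "{i}" "{i}" D] by (simp add: sum_subtractf right_diff_distrib)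
    also have "(\<Sum>t\<in>T. of_bool (out t) * (K i D {} {} t - K i D {i} {i} t))
        \<le> 2 / \<epsilon> * H i D {} {} {i} {i} + \<epsilon> * N / 2"
      unfolding H_def using i assms(2) \<epsilon>
      by (intro sum_diff_le_hellinger K_total) (auto simp: K_def)
    finally show "(\<Sum>z\<in>Pow (I - {i}). of_bool (out (\<tau> (z \<inter> D) (z - D)))
           + of_bool (\<not> out (\<tau> (insert i (z \<inter> D)) (insert i (z - D)))))
        \<le> N + \<epsilon> * N / 2 + 2 / \<epsilon> * H i D {} {} {i} {i}"
      by simp
  qed
  also have "\<dots> = m * N\<^sup>2 * (1 + \<epsilon> / 2) + 2 / \<epsilon> * (\<Sum>i\<in>I. \<Sum>D\<in>Pow (I - {i}). H i D {} {} {i} {i})"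
  proof -
    have "(\<Sum>i\<in>I. \<Sum>D\<in>Pow (I - {i}). N + \<epsilon> * N / 2) = m * N\<^sup>2 * (1 + \<epsilon> / 2)"
      by (simp add: card_Pow_remove m_def power2_eq_square distrib_left)
    moreover have "(\<Sum>i\<in>I. \<Sum>D\<in>Pow (I - {i}). N + \<epsilon> * N / 2 + 2 / \<epsilon> * H i D {} {} {i} {i})
        = (\<Sum>i\<in>I. \<Sum>D\<in>Pow (I - {i}). N + \<epsilon> * N / 2)
          + (\<Sum>i\<in>I. \<Sum>D\<in>Pow (I - {i}). 2 / \<epsilon> * H i D {} {} {i} {i})"
      by (simp only: flip: sum.distrib)
    ultimately show ?thesis
      by (simp only: sum_distrib_left)
  qed
  also have "\<dots> \<le> m * N\<^sup>2 * (1 + \<epsilon> / 2) + 2 / \<epsilon> * (16 * N\<^sup>2 * ln (card T))"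
    using \<epsilon> upper by (intro add_left_mono mult_left_mono) auto
  finally have "N\<^sup>2 * (p * 2 * m) \<le> N\<^sup>2 * (m * (1 + \<epsilon> / 2) + 32 / \<epsilon> * ln (card T))"
    by (simp add: algebra_simps)
  hence "p * 2 * m \<le> m * (1 + \<epsilon> / 2) + 32 / \<epsilon> * ln (card T)"
    using N by simp
  \<comment> \<open>Success exceeds \<open>m\<close> by \<open>\<epsilon> * m\<close>, and half of
    this survives on the left to be paid for by \<open>ln (card T)\<close>.\<close>
  moreover have "p * 2 * m = m + \<epsilon> * m" "m * (1 + \<epsilon> / 2) = m + \<epsilon> * m / 2"
    by (simp_all add: \<epsilon>_def algebra_simps)
  ultimately have "\<epsilon> * m \<le> 64 / \<epsilon> * ln (card T)"
    by simp
  hence "\<epsilon> * (\<epsilon> * m) \<le> \<epsilon> * (64 / \<epsilon> * ln (card T))"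
    using \<epsilon> by (intro mult_left_mono) auto
  thus ?thesis
    using \<epsilon> unfolding \<epsilon>_def[symmetric] m_def by (simp add: power2_eq_square mult_ac)
qed

text \<open>Used to fix one random tape that does at least as well as the average on the hard
  inputs, leaving a deterministic protocol.\<close>

lemma (in prob_space) exists_ge_expectation:
  fixes f :: "'a \<Rightarrow> real"
  assumes "integrable M f"
  shows "\<exists>x\<in>space M. expectation f \<le> f x"
proof (rule ccontr)
  assume "\<not> ?thesis"
  hence "AE x in M. f x < expectation f"
    by (intro AE_I2) (auto simp: not_le)
  from expectation_less[OF assms this] show False
    by simp
qed

section \<open>The cost of the hard instances\<close>

lemma index_mult_unit_row:
  fixes X D :: "real mat"
  assumes "X \<in> carrier_mat n k" "D \<in> carrier_mat k d" "i < n" "j < d" "c < k"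
    and "Matrix.row X i = unit_vec k c"
  shows "(X * D) $$ (i, j) = D $$ (c, j)"
proof -
  have "(X * D) $$ (i, j) = Matrix.row X i \<bullet> Matrix.col D j"
    using assms by (subst index_mult_mat) auto
  also have "\<dots> = D $$ (c, j)"
    using assms by (simp add: scalar_prod_left_unit[of _ k])
  finally show ?thesis .
qed

lemma index_assignment_mult:
  assumes "X \<in> assignment_mats n k" "D \<in> carrier_mat k d" "i < n"
  shows "\<exists>c<k. \<forall>j<d. (X * D) $$ (i, j) = D $$ (c, j)"
proof -
  obtain c where "c < k" "Matrix.row X i = unit_vec k c"
    using assms by (auto simp: assignment_mats_def)
  thus ?thesis
    using index_mult_unit_row[OF _ assms(2,3)] assms(1) by (auto simp: assignment_mats_def)
qed

lemma opt_cost_le: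
  assumes "X \<in> assignment_mats n k" "D \<in> carrier_mat k d"
  shows "opt_cost n k d A \<le> frob_sq (X * D - A)"
proof -
  have "bdd_below ((\<lambda>(X, D). frob_sq (X * D - A)) ` (assignment_mats n k \<times> carrier_mat k d))"
    by (rule bdd_belowI[of _ 0]) (auto simp: frob_sq_def intro!: sum_nonneg)
  hence "opt_cost n k d A \<le> (case (X, D) of (X, D) \<Rightarrow> frob_sq (X * D - A))"
    unfolding opt_cost_def using assms by (intro cINF_lower) auto
  thus ?thesis by simp
qed

lemma opt_cost_ge:
  assumes "k > 0"
    and "\<And>X D. X \<in> assignment_mats n k \<Longrightarrow> D \<in> carrier_mat k d \<Longrightarrow> c \<le> frob_sq (X * D - A)"
  shows "c \<le> opt_cost n k d A"
proof -
  \<comment> \<open>Putting every row into cluster 0 shows that the infimum ranges over a nonempty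
    set.\<close>
  have "Matrix.mat n k (\<lambda>(i, j). if j = 0 then 1 else 0) \<in> assignment_mats n k"
    using \<open>k > 0\<close> by (auto simp: assignment_mats_def unit_vec_def intro!: exI[of _ 0])
  hence "assignment_mats n k \<times> carrier_mat k d \<noteq> {}"
    using zero_carrier_mat[of k d] by blast
  thus ?thesis
    unfolding opt_cost_def using assms(2) by (intro cINF_greatest) auto
qed

lemma opt_cost_two_values:
  assumes A: "A \<in> carrier_mat n 1" and "\<And>i. i < n \<Longrightarrow> A $$ (i, 0) \<in> {u, v}"
  shows "opt_cost n 2 1 A = 0"
proof (rule antisym)
  define c where "c i = (if A $$ (i, 0) = u then 0 else 1 :: nat)" for i
  define X :: "real mat" where "X = Matrix.mat n 2 (\<lambda>(i, j). if j = c i then 1 else 0)"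
  define D :: "real mat" where "D = Matrix.mat 2 1 (\<lambda>(i, j). if i = 0 then u else v)"
  have row: "Matrix.row X i = unit_vec 2 (c i)" "c i < 2" if "i < n" for i
    using that by (auto simp: X_def unit_vec_def c_def)
  have X: "X \<in> assignment_mats n 2"
    unfolding assignment_mats_def using row by (auto simp: X_def)
  have D: "D \<in> carrier_mat 2 1"
    by (simp add: D_def)
  have "(X * D) $$ (i, 0) = A $$ (i, 0)" if "i < n" for i
  proof -
    have "(X * D) $$ (i, 0) = D $$ (c i, 0)"
      using row[OF that] D that by (intro index_mult_unit_row) (auto simp: X_def)
    thus ?thesis
      using assms(2)[OF that] by (auto simp: D_def c_def)
  qed
  hence "frob_sq (X * D - A) = 0"
    using A by (simp add: frob_sq_def)
  thus "opt_cost n 2 1 A \<le> 0"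
    using opt_cost_le[OF X D, of A] by simp
  show "0 \<le> opt_cost n 2 1 A"
    by (rule opt_cost_ge) (auto simp: frob_sq_def intro!: sum_nonneg)
qed

text \<open>Pigeonhole: two of the three rows share a cluster, hence a centre. Their errors differ
  by at least \<delta>, so the squares of these errors sum to at least half of the square of
  \<delta>.\<close>

lemma opt_cost_three_values:
  assumes A: "A \<in> carrier_mat n 1" and ijk: "i < n" "j < n" "k < n"
    and sep: "\<delta> \<le> \<bar>A $$ (i, 0) - A $$ (j, 0)\<bar>" "\<delta> \<le> \<bar>A $$ (i, 0) - A $$ (k, 0)\<bar>"
      "\<delta> \<le> \<bar>A $$ (j, 0) - A $$ (k, 0)\<bar>" and "\<delta> > 0"
  shows "\<delta>\<^sup>2 / 2 \<le> opt_cost n 2 1 A"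
proof (rule opt_cost_ge)
  fix X D :: "real mat" assume X: "X \<in> assignment_mats n 2" and D: "D \<in> carrier_mat 2 1"
  have pair: "\<delta>\<^sup>2 / 2 \<le> frob_sq (X * D - A)"
    if xy: "x < n" "y < n" "\<delta> \<le> \<bar>A $$ (x, 0) - A $$ (y, 0)\<bar>"
      and same: "(X * D) $$ (x, 0) = (X * D) $$ (y, 0)" for x y
  proof -
    define e where "e r = (X * D - A) $$ (r, 0)" for r
    have "x \<noteq> y"
      using xy \<open>\<delta> > 0\<close> by auto
    have "A $$ (x, 0) - A $$ (y, 0) = e y - e x"
      using xy same A X D by (simp add: e_def assignment_mats_def)
    hence "\<delta>\<^sup>2 \<le> (e y - e x)\<^sup>2"
      using xy(3) \<open>\<delta> > 0\<close> by (metis abs_le_square_iff abs_of_pos)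
    also have "\<dots> \<le> 2 * ((e x)\<^sup>2 + (e y)\<^sup>2)"
      using zero_le_power2[of "e x + e y"] by (simp add: power2_sum power2_diff mult_ac)
    also have "(e x)\<^sup>2 + (e y)\<^sup>2 = (\<Sum>r\<in>{x, y}. (e r)\<^sup>2)"
      using \<open>x \<noteq> y\<close> by simp
    also have "\<dots> \<le> (\<Sum>r<n. (e r)\<^sup>2)"
      using xy by (intro sum_mono2) auto
    also have "\<dots> = frob_sq (X * D - A)"
      using A X D by (simp add: frob_sq_def e_def)
    finally show ?thesis by simp
  qed
  obtain c1 where c1: "c1 < 2" "(X * D) $$ (i, 0) = D $$ (c1, 0)"
    using index_assignment_mult[OF X D ijk(1)] by auto
  obtain c2 where c2: "c2 < 2" "(X * D) $$ (j, 0) = D $$ (c2, 0)"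
    using index_assignment_mult[OF X D ijk(2)] by auto
  obtain c3 where c3: "c3 < 2" "(X * D) $$ (k, 0) = D $$ (c3, 0)"
    using index_assignment_mult[OF X D ijk(3)] by auto
  have "c1 = c2 \<or> c1 = c3 \<or> c2 = c3"
    using c1 c2 c3 by linarith
  thus "\<delta>\<^sup>2 / 2 \<le> frob_sq (X * D - A)"
    using pair[OF ijk(1,2)] pair[OF ijk(1,3)] pair[OF ijk(2,3)] sep c1 c2 c3 by auto
qed simp

section \<open>Streams encoding a pair of sets\<close>

text \<open>All these streams have length \<open>n\<close>, so Bob knows the position in the stream at which his part starts.\<close>
definition sign_stream :: "nat \<Rightarrow> nat set \<Rightarrow> update list" where
  "sign_stream n x = map (\<lambda>i. (i, 0, if i \<in> x then 1 else - 1)) [0..<n]"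

lemma length_sign_stream [simp]: "length (sign_stream n x) = n"
  by (simp add: sign_stream_def)

lemma foldl_apply_update_column:
  assumes "A \<in> carrier_mat n 1" "k \<le> n"
  shows "foldl apply_update A (map (\<lambda>i. (i, 0, f i)) [0..<k])
    = Matrix.mat n 1 (\<lambda>(r, c). A $$ (r, c) + (if r < k then f r else 0))"
  using assms(2)
proof (induction k)
  case 0
  show ?case
    using assms(1) by (auto intro!: eq_matI)
next
  case (Suc k)
  thus ?case
    by (auto intro!: eq_matI simp: less_Suc_eq)
qed

lemma stream_mat_sign_streams:
  "stream_mat n 1 (sign_stream n x @ sign_stream n y)
    = Matrix.mat n 1 (\<lambda>(r, c). (if r \<in> x then 1 else - 1) + (if r \<in> y then 1 else - 1))"
proof -
  have "foldl apply_update A (sign_stream n z)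
      = Matrix.mat n 1 (\<lambda>(r, c). A $$ (r, c) + (if r < n then if r \<in> z then 1 else - 1 else 0))"
    if "A \<in> carrier_mat n 1" for A z
    unfolding sign_stream_def using that by (rule foldl_apply_update_column) simp
  thus ?thesis
    by (auto simp: stream_mat_def intro!: eq_matI)
qed

lemma sign_streams_in_short_unit_streams:
  "sign_stream n x @ sign_stream n y \<in> short_unit_streams n 1"
  by (auto simp: short_unit_streams_def sign_stream_def split: if_splits)

lemma opt_cost_disjoint:
  assumes "x \<inter> y = {}"
  shows "opt_cost n 2 1 (stream_mat n 1 (sign_stream n x @ sign_stream n y)) = 0"
  unfolding stream_mat_sign_streams
  using assms by (intro opt_cost_two_values[of _ _ "- 2" 0]) auto

text \<open>Rows \<open>i\<close>, \<open>j\<close> and \<open>k\<close> carry the values 2, 0 and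
  -2, which are pairwise at distance at least 2.\<close>

lemma opt_cost_intersecting:
  assumes "i \<in> x \<inter> y" "j \<in> x - y" "k \<notin> x \<union> y" "i < n" "j < n" "k < n"
  shows "opt_cost n 2 1 (stream_mat n 1 (sign_stream n x @ sign_stream n y)) > 0"
proof -
  have "(2::real)\<^sup>2 / 2 \<le> opt_cost n 2 1 (stream_mat n 1 (sign_stream n x @ sign_stream n y))"
    unfolding stream_mat_sign_streams
    using assms by (intro opt_cost_three_values[of _ _ i j k]) auto
  thus ?thesis by simp
qed

section \<open>Transcripts of multi-pass algorithms\<close>

lemma run_pass_append:
  "run_pass alg \<rho> q t (\<sigma> @ \<sigma>') m = run_pass alg \<rho> q (t + length \<sigma>) \<sigma>' (run_pass alg \<rho> q t \<sigma> m)"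
  by (induction \<sigma> arbitrary: t m) simp_all

lemma length_run_pass:
  assumes "uses_bits alg s" "\<rho> \<in> space (tape_distr alg)" "length m = s"
  shows "length (run_pass alg \<rho> q t \<sigma> m) = s"
  using assms(3) by (induction \<sigma> arbitrary: t m) (use assms(1,2) in \<open>auto simp: uses_bits_def\<close>)

lemma length_run_passes:
  assumes "uses_bits alg s" "\<rho> \<in> space (tape_distr alg)"
  shows "length (run_passes alg \<rho> q \<sigma>) = s"
proof (induction q)
  case 0
  thus ?case
    using assms by (simp add: uses_bits_def)
qed (simp add: length_run_pass[OF assms])

text \<open>The memory after Alice's part and after Bob's part of each pass.\<close>
definition transcript :: "stream_alg \<Rightarrow> tape \<Rightarrow> nat \<Rightarrow> update list \<Rightarrow> update list \<Rightarrow> (bool list \<times> bool list) list" where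
  "transcript alg \<rho> P \<sigma> \<sigma>' =
     map (\<lambda>q. (run_pass alg \<rho> q 0 \<sigma> (run_passes alg \<rho> q (\<sigma> @ \<sigma>')), run_passes alg \<rho> (Suc q) (\<sigma> @ \<sigma>'))) [0..<P]"

text \<open>Reads the memory before pass \<open>q\<close> off a transcript, so that Alice's
  condition on a candidate transcript does not mention Bob's stream.\<close>

definition start_mem :: "stream_alg \<Rightarrow> tape \<Rightarrow> (bool list \<times> bool list) list \<Rightarrow> nat \<Rightarrow> bool list" where
  "start_mem alg \<rho> t q = (case q of 0 \<Rightarrow> init_mem alg \<rho> | Suc q' \<Rightarrow> snd (t ! q'))"

lemma start_mem_transcript:
  assumes "q \<le> P"
  shows "start_mem alg \<rho> (transcript alg \<rho> P \<sigma> \<sigma>') q = run_passes alg \<rho> q (\<sigma> @ \<sigma>')"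
  using assms by (cases q) (simp_all add: start_mem_def transcript_def)

text \<open>The first condition involves only Alice's stream, the second only Bob's and the length
  of Alice's, which is constant in the application. Conversely, induction over the passes shows that
  consistent entries are the actual memories.\<close>

lemma transcript_rectangle:
  assumes "length t = P"
  shows "transcript alg \<rho> P \<sigma> \<sigma>' = t \<longleftrightarrow>
    (\<forall>q<P. fst (t ! q) = run_pass alg \<rho> q 0 \<sigma> (start_mem alg \<rho> t q)) \<and>
    (\<forall>q<P. snd (t ! q) = run_pass alg \<rho> q (length \<sigma>) \<sigma>' (fst (t ! q)))"
    (is "_ \<longleftrightarrow> ?A \<and> ?B")
proof
  assume t: "transcript alg \<rho> P \<sigma> \<sigma>' = t"
  have "start_mem alg \<rho> t q = run_passes alg \<rho> q (\<sigma> @ \<sigma>')" if "q < P" for q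
    using that start_mem_transcript[of q P alg \<rho> \<sigma> \<sigma>'] t by simp
  moreover have "fst (t ! q) = run_pass alg \<rho> q 0 \<sigma> (run_passes alg \<rho> q (\<sigma> @ \<sigma>'))"
    "snd (t ! q) = run_passes alg \<rho> (Suc q) (\<sigma> @ \<sigma>')" if "q < P" for q
    using that unfolding t[symmetric] by (simp_all add: transcript_def)
  ultimately show "?A \<and> ?B"
    by (simp add: run_pass_append)
next
  assume AB: "?A \<and> ?B"
  have mem: "start_mem alg \<rho> t q = run_passes alg \<rho> q (\<sigma> @ \<sigma>')" if "q \<le> P" for q
    using that
  proof (induction q)
    case (Suc q)
    thus ?case
      using AB by (simp add: start_mem_def[of _ _ _ "Suc q"] run_pass_append)
  qed (simp add: start_mem_def)
  show "transcript alg \<rho> P \<sigma> \<sigma>' = t"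
  proof (rule nth_equalityI)
    fix q assume "q < length (transcript alg \<rho> P \<sigma> \<sigma>')"
    hence "q < P"
      by (simp add: transcript_def)
    thus "transcript alg \<rho> P \<sigma> \<sigma>' ! q = t ! q"
      using AB mem[of q] by (intro prod_eqI) (simp_all add: transcript_def run_pass_append)
  qed (simp add: transcript_def assms)
qed

text \<open>Disjointness on \<open>m\<close> coordinates embeds into \<open>m + 2\<close> rows.
  Averaging over the hard inputs fixes a tape, and the transcripts on it form the deterministic
  protocol to be bounded.\<close>

lemma multi_pass_space_bound:
  fixes p :: real
  assumes bits: "uses_bits alg s" and approx: "approximates_opt alg P p (m + 2) 2 1 S"
    and S: "short_unit_streams (m + 2) 1 \<subseteq> S" and p: "p > 1 / 2"
  shows "(2 * p - 1)\<^sup>2 * m \<le> 128 * P * s"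
proof -
  define n where "n = m + 2"
  \<comment> \<open>Coordinates \<open>m\<close> and \<open>m + 1\<close> are fixed to make the values \<open>-2\<close> and \<open>0\<close> occur, so that
    one common element of \<open>x\<close> and \<open>y\<close> creates a third value.\<close>
  define \<sigma>1 \<sigma>2 where "\<sigma>1 x = sign_stream n (insert (m + 1) x)" and "\<sigma>2 y = sign_stream n y" for x y
  define \<sigma> where "\<sigma> x y = \<sigma>1 x @ \<sigma>2 y" for x y
  interpret prob_space "tape_distr alg"
    using approx by (simp add: approximates_opt_def)
  define good where "good x y = {\<rho> \<in> space (tape_distr alg).
      0 \<le> alg_output alg P (\<sigma> x y) \<rho> \<and>
      alg_output alg P (\<sigma> x y) \<rho> \<le> opt_cost n 2 1 (stream_mat n 1 (\<sigma> x y)) \<and>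
      opt_cost n 2 1 (stream_mat n 1 (\<sigma> x y)) \<le> 2 * alg_output alg P (\<sigma> x y) \<rho>}" for x y
  have good_prob: "p \<le> prob (good x y)" for x y
  proof -
    have "\<sigma> x y \<in> S"
      using S sign_streams_in_short_unit_streams[of n] by (auto simp: \<sigma>_def \<sigma>1_def \<sigma>2_def n_def)
    thus ?thesis
      using approx by (auto simp: approximates_opt_def good_def n_def)
  qed
  \<comment> \<open>A set that is not an event would have measure 0, below \<open>p\<close>.\<close>
  have [measurable]: "good x y \<in> events" for x y
    using good_prob[of x y] p measure_notin_sets[of "good x y" "tape_distr alg"] by force
  define I where "I = {..<m}"
  define f where "f \<rho> = (\<Sum>i\<in>I. \<Sum>D\<in>Pow (I - {i}). \<Sum>z\<in>Pow (I - {i}).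
      indicat_real (good (z \<inter> D) (z - D)) \<rho>
      + indicat_real (good (insert i (z \<inter> D)) (insert i (z - D))) \<rho>)" for \<rho>
  have ind: "integrable (tape_distr alg) (indicat_real (good x y))" for x y
    by (simp add: integrable_indicator_iff less_top[symmetric])
  have int_f: "integrable (tape_distr alg) f"
    unfolding f_def by (intro Bochner_Integration.integrable_sum Bochner_Integration.integrable_add ind)
  have "p * (\<Sum>i\<in>I. \<Sum>D\<in>Pow (I - {i}). \<Sum>z\<in>Pow (I - {i}). 2)
      = (\<Sum>i\<in>I. \<Sum>D\<in>Pow (I - {i}). \<Sum>z\<in>Pow (I - {i}). p + p)"
    by (simp add: sum_distrib_left mult_ac)
  also have "\<dots> \<le> (\<Sum>i\<in>I. \<Sum>D\<in>Pow (I - {i}). \<Sum>z\<in>Pow (I - {i}).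
      prob (good (z \<inter> D) (z - D)) + prob (good (insert i (z \<inter> D)) (insert i (z - D))))"
    by (intro sum_mono add_mono good_prob)
  also have "\<dots> = expectation f"
    unfolding f_def using ind by (simp add: Int_absorb2 sets.sets_into_space)
  finally obtain \<rho> where \<rho>: "\<rho> \<in> space (tape_distr alg)"
    "p * (\<Sum>i\<in>I. \<Sum>D\<in>Pow (I - {i}). \<Sum>z\<in>Pow (I - {i}). 2) \<le> f \<rho>"
    using exists_ge_expectation[OF int_f] by force

  define L :: "bool list set" where "L = {m. length m = s}"
  define T where "T = {t. set t \<subseteq> L \<times> L \<and> length t = P}"
  have L: "finite L" "card L = 2 ^ s"
    unfolding L_def using finite_lists_length_eq[of "UNIV :: bool set" s] card_lists_length_eq[of "UNIV :: bool set" s]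
    by simp_all
  have finite_T: "finite T"
    unfolding T_def using L by (intro finite_lists_length_eq) simp
  have card_T: "card T = (2 ^ s * 2 ^ s) ^ P"
    unfolding T_def using L by (subst card_lists_length_eq) (simp_all add: card_cartesian_product)
  define \<tau> where "\<tau> x y = transcript alg \<rho> P (\<sigma>1 x) (\<sigma>2 y)" for x y
  \<comment> \<open>A successful answer is 0 exactly when the cost is 0. Index \<open>P\<close>
    gives the final memory, so on the fixed tape the verdict depends on the transcript
    alone.\<close>
  define out where "out t \<longleftrightarrow> answer alg \<rho> (start_mem alg \<rho> t P) = 0" for t
  have out: "out (\<tau> x y) \<longleftrightarrow> alg_output alg P (\<sigma> x y) \<rho> = 0" for x y
    by (simp add: out_def \<tau>_def start_mem_transcript alg_output_def \<sigma>_def)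
  have "(2 * p - 1)\<^sup>2 * card I \<le> 64 * ln (card T)"
  proof (rule disjointness_transcript_bound)
    show "finite I"
      by (simp add: I_def)
    show "\<tau> x y \<in> T" for x y
      using length_run_pass[OF bits \<rho>(1)] length_run_passes[OF bits \<rho>(1)]
      by (auto simp: \<tau>_def T_def L_def transcript_def simp del: run_passes.simps)
    show "\<tau> x y = t \<longleftrightarrow>
        (\<forall>q<P. fst (t ! q) = run_pass alg \<rho> q 0 (\<sigma>1 x) (start_mem alg \<rho> t q)) \<and>
        (\<forall>q<P. snd (t ! q) = run_pass alg \<rho> q n (\<sigma>2 y) (fst (t ! q)))" if "t \<in> T" for x y t
      using that transcript_rectangle[of t P alg \<rho> "\<sigma>1 x" "\<sigma>2 y"]
      by (simp add: \<tau>_def T_def \<sigma>1_def)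
    note \<rho>(2)
    also have "f \<rho> \<le> (\<Sum>i\<in>I. \<Sum>D\<in>Pow (I - {i}). \<Sum>z\<in>Pow (I - {i}).
           of_bool (out (\<tau> (z \<inter> D) (z - D)))
           + of_bool (\<not> out (\<tau> (insert i (z \<inter> D)) (insert i (z - D)))))"
      unfolding f_def
    proof (intro sum_mono add_mono)
      fix i D z assume i: "i \<in> I" and D: "D \<in> Pow (I - {i})" and z: "z \<in> Pow (I - {i})"
      \<comment> \<open>Hence \<open>m + 1\<close> belongs to Alice only and \<open>m\<close> to
        neither player, for both kinds of input.\<close>
      have "m + 1 \<notin> z" "m \<notin> z"
        using z by (auto simp: I_def)
      hence "opt_cost n 2 1 (stream_mat n 1 (\<sigma> (z \<inter> D) (z - D))) = 0"
        unfolding \<sigma>_def \<sigma>1_def \<sigma>2_def by (intro opt_cost_disjoint) auto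
      thus "indicat_real (good (z \<inter> D) (z - D)) \<rho> \<le> of_bool (out (\<tau> (z \<inter> D) (z - D)))"
        by (auto simp: good_def out indicator_def)
      have "opt_cost n 2 1 (stream_mat n 1 (\<sigma> (insert i (z \<inter> D)) (insert i (z - D)))) > 0"
        unfolding \<sigma>_def \<sigma>1_def \<sigma>2_def using i \<open>m \<notin> z\<close> \<open>m + 1 \<notin> z\<close>
        by (intro opt_cost_intersecting[of i _ _ "m + 1" m]) (auto simp: I_def n_def)
      thus "indicat_real (good (insert i (z \<inter> D)) (insert i (z - D))) \<rho>
          \<le> of_bool (\<not> out (\<tau> (insert i (z \<inter> D)) (insert i (z - D))))"
        by (auto simp: good_def out indicator_def)
    qed
    finally show "p * (\<Sum>i\<in>I. \<Sum>D\<in>Pow (I - {i}). \<Sum>z\<in>Pow (I - {i}). 2)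
      \<le> (\<Sum>i\<in>I. \<Sum>D\<in>Pow (I - {i}). \<Sum>z\<in>Pow (I - {i}).
           of_bool (out (\<tau> (z \<inter> D) (z - D)))
           + of_bool (\<not> out (\<tau> (insert i (z \<inter> D)) (insert i (z - D)))))" .
  qed (use finite_T p in auto)
  \<comment> \<open>Each pass contributes two memories of \<open>s\<close> bits, one per
    player.\<close>
  also have "ln (real (card T)) = 2 * P * s * ln 2"
    by (simp add: card_T ln_realpow ln_mult)
  also have "\<dots> \<le> real (2 * P * s) * 1"
    using ln_2_less_1 by (intro mult_left_mono) auto
  finally show ?thesis
    by (simp add: I_def)
qed

theorem mainTheorem15:
  fixes P :: nat and p :: real and S :: "nat \<Rightarrow> update list set"
  assumes "p > 1 / 2"
    and "\<And>n. short_unit_streams n 1 \<subseteq> S n"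
    and "\<And>n. S n \<subseteq> turnstile_streams n 1"
  shows "\<exists>lb :: nat \<Rightarrow> nat. (\<lambda>n. real (lb n)) \<in> \<Omega>(\<lambda>n. real n) \<and>
           (\<forall>n s alg. uses_bits alg s \<and> approximates_opt alg P p n 2 1 (S n) \<longrightarrow> lb n \<le> s)"
proof -
  \<comment> \<open>The summand 1 keeps the denominator positive for \<open>P = 0\<close>.\<close>
  define a where "a = (2 * p - 1)\<^sup>2 / (128 * P + 1)"
  have a: "a > 0"
    using assms(1) by (auto simp: a_def intro!: divide_pos_pos)
  define lb where "lb n = nat \<lfloor>a * (real n - 2)\<rfloor>" for n
  have "eventually (\<lambda>n. norm (real (lb n)) \<ge> a / 2 * norm (real n)) at_top"
    \<comment> \<open>From this threshold on, half of \<open>a * n\<close> covers the loss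
      \<open>2 * a\<close> from the two fixed rows and the loss of at most 1 from rounding
      down.\<close>
    using eventually_ge_at_top[of "nat \<lceil>2 * (2 * a + 1) / a\<rceil>"]
  proof eventually_elim
    case (elim n)
    hence "2 * (2 * a + 1) / a \<le> real n"
      by linarith
    hence "a * real n / 2 \<le> a * (real n - 2) - 1"
      using a by (simp add: field_simps)
    also have "\<dots> \<le> real (lb n)"
      unfolding lb_def by linarith
    finally show ?case
      using a by (simp add: field_simps)
  qed
  hence "(\<lambda>n. real (lb n)) \<in> \<Omega>(\<lambda>n. real n)"
    using a by (intro landau_omega.bigI[of "a / 2"]) auto
  moreover have "lb n \<le> s" if "uses_bits alg s" "approximates_opt alg P p n 2 1 (S n)" for n s alg
  proof (cases "n \<ge> 2")
    case True
    then obtain m where m: "n = m + 2"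
      by (metis add.commute le_Suc_ex)
    have "(2 * p - 1)\<^sup>2 * m \<le> 128 * P * s"
      using that assms(1,2) unfolding m by (intro multi_pass_space_bound) auto
    also have "\<dots> \<le> (128 * P + 1) * s"
      by simp
    finally have "a * m \<le> s"
      by (simp add: a_def pos_divide_le_eq algebra_simps)
    thus ?thesis
      unfolding lb_def m by simp linarith
  next
    case False
    hence "a * (real n - 2) \<le> 0"
      using a by (simp add: mult_le_0_iff)
    thus ?thesis
      unfolding lb_def by linarith
  qed
  ultimately show ?thesis
    by blast
qed

end
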